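(* The function $f:[0,1]\to\mathbb{R}$ defined by $$f(x)=\delta_{\alpha_1(x)1}+\sum_{k=2}^{\infty}\left[\delta_{\alpha_k(x)k}\prod_{j=1}^{k-1}g_{\alpha_j(x)j}\right]\quad\text{for } x=\Delta^{Q_3^*}_{\alpha_1(x)\alpha_2(x)\ldots\alpha_k(x)\ldots}$$ is continuous at every point of the interval $[0,1]$.
   Context: Let $\|q_{ik}\|$ ($i\in\{0,1,2\}$, $k\in\mathbb{N}=\{1,2,\ldots\}$) be an infinite matrix with $q_{ik}>0$ and $q_{0k}+q_{1k}+q_{2k}=1$ for all $k$. Put $\beta_{0k}=0$, $\beta_{1k}=q_{0k}$, $\beta_{2k}=q_{0k}+q_{1k}$. For a sequence $(\alpha_k)$ with $\alpha_k\in\{0,1,2\}$ write $$\Delta^{Q_3^*}_{\alpha_1\alpha_2\ldots\alpha_k\ldots}=\beta_{\alpha_1 1}+\sum_{k=2}^{\infty}\Big[\beta_{\alpha_k k}\prod_{j=1}^{k-1}q_{\alpha_j j}\Big].$$ The matrix is assumed to define a representation of numbers, i.e. every $x\in[0,1]$ equals $\Delta^{Q_3^*}_{\alpha_1\alpha_2\ldots}$ for some sequence $\alpha_k=\alpha_k(x)$. Let $(\varepsilon_k)_{k\ge1}$ be a sequence of real numbers with $0\le\varepsilon_k\le1$. Put $g_{0k}=g_{2k}=\frac{1+\varepsilon_k}{3}$, $g_{1k}=\frac{1-2\varepsilon_k}{3}$, $\delta_{0k}=0$, $\delta_{1k}=g_{0k}$, $\delta_{2k}=g_{0k}+g_{1k}$.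 The value $f(x)$ does not depend on the choice of representation when $x$ has two representations. *)

theory Defs
  imports "HOL-Analysis.Analysis"
begin

text \<open>
  Positions are the natural numbers \<open>k \<ge> 1\<close>; values at position \<open>0\<close> are never used.
  A matrix is written \<open>p i k\<close> with digit \<open>i \<in> {0, 1, 2}\<close> and position \<open>k\<close>.
\<close>

definition digit_seq :: "(nat \<Rightarrow> nat) \<Rightarrow> bool" where
  "digit_seq \<alpha> \<longleftrightarrow> (\<forall>k\<ge>1. \<alpha> k \<in> {0, 1, 2})"

text \<open>
  The numbers \<open>\<beta>\<close> (for \<open>p = q\<close>) and \<open>\<delta>\<close> (for \<open>p = g_matrix \<epsilon>\<close>): the values for
  \<open>i = 0, 1, 2\<close> are \<open>0\<close>, \<open>p 0 k\<close>, \<open>p 0 k + p 1 k\<close>.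
\<close>

definition offset :: "(nat \<Rightarrow> nat \<Rightarrow> real) \<Rightarrow> nat \<Rightarrow> nat \<Rightarrow> real" where
  "offset p i k = (\<Sum>l<i. p l k)"

text \<open>
  The series runs over the positions \<open>k + 2\<close> for \<open>k \<ge> 0\<close>, that is, over \<open>2, 3, \<dots>\<close>.
  The number \<open>\<Delta>\<close> with digits \<open>\<alpha>\<close> is \<open>expansion q \<alpha>\<close>.
\<close>

definition expansion :: "(nat \<Rightarrow> nat \<Rightarrow> real) \<Rightarrow> (nat \<Rightarrow> nat) \<Rightarrow> real" where
  "expansion p \<alpha> =
     offset p (\<alpha> 1) 1
     + (\<Sum>k. offset p (\<alpha> (k + 2)) (k + 2) * (\<Prod>j = 1..k + 1. p (\<alpha> j) j))"

definition g_matrix :: "(nat \<Rightarrow> real) \<Rightarrow> nat \<Rightarrow> nat \<Rightarrow> real" where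
  "g_matrix \<epsilon> i k = (if i = 1 then (1 - 2 * \<epsilon> k) / 3 else (1 + \<epsilon> k) / 3)"

text \<open>
  A number may have two representations. The value is the one common to all
  representations of \<open>x\<close>, so no representation is singled out.
\<close>

definition Q3_fun :: "(nat \<Rightarrow> nat \<Rightarrow> real) \<Rightarrow> (nat \<Rightarrow> real) \<Rightarrow> real \<Rightarrow> real" where
  "Q3_fun q \<epsilon> x =
     (THE y. \<exists>\<alpha>. digit_seq \<alpha> \<and> x = expansion q \<alpha> \<and> y = expansion (g_matrix \<epsilon>) \<alpha>)"

end

theory Submission
  imports Defs
begin

text \<open>
  The function is a uniform limit of continuous functions. Removing the first digit of an
  expansion is an affine change of variable (\<open>expansion_rec\<close>): if \<open>x'\<close> has the digits of \<open>x\<close>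
  without the first digit \<open>i\<close>, and positions are counted from \<open>2\<close>, then
  \<open>x = \<beta>\<^sub>i\<^sub>1 + q\<^sub>i\<^sub>1 x'\<close>, while the value sought satisfies \<open>f x = \<delta>\<^sub>i\<^sub>1 + g\<^sub>i\<^sub>1 f' x'\<close> with the function
  \<open>f'\<close> of the shifted matrices. Starting from the identity and applying this rule \<open>n\<close> times gives
  a function \<open>digit_approx n\<close> which is affine on every cylinder of rank \<open>n\<close>; these cylinders tile
  the unit interval because \<open>q\<close> is positive with column sums \<open>1\<close>. The function fixes \<open>0\<close> and \<open>1\<close>, so its pieces agree at common endpoints of neighbouring cylinders, and it is continuous
  (\<open>digit_approx_continuous\<close>).

  Each application multiplies errors by some \<open>g\<^sub>i\<^sub>k\<close>, and \<open>\<bar>g\<^sub>i\<^sub>k\<bar> \<le> 2/3\<close>. Therefore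
  \<open>digit_approx n\<close> at \<open>expansion q \<alpha>\<close> differs from \<open>expansion g \<alpha>\<close> by at most \<open>(2/3)\<^sup>n\<close>, whatever
  the digits \<open>\<alpha>\<close> are (\<open>digit_approx_error\<close>). This gives uniform convergence, and it also shows
  that the value depends on \<open>x\<close> alone: for every representation of \<open>x\<close> it is the limit of
  \<open>digit_approx n x\<close>.
\<close>

section \<open>Expansions in ternary weights\<close>

text \<open>
  Besides column sums \<open>1\<close>, the condition says that the points \<open>0\<close>, \<open>p 0 k\<close>, \<open>p 0 k + p 1 k\<close>, \<open>1\<close>
  lie in the unit interval, in any order; equivalently, each affine map \<open>t \<mapsto> offset p i k + p i k * t\<close> sends the unit interval
  into itself. It covers the positive matrix \<open>q\<close> as well as \<open>g_matrix \<epsilon>\<close>, whose middle row may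
  have negative entries.
\<close>

definition ternary_weights :: "(nat \<Rightarrow> nat \<Rightarrow> real) \<Rightarrow> bool" where
  "ternary_weights p \<longleftrightarrow> (\<forall>k\<ge>1. p 0 k + p 1 k + p 2 k = 1 \<and>
     0 \<le> p 0 k \<and> p 0 k \<le> 1 \<and> 0 \<le> p 0 k + p 1 k \<and> p 0 k + p 1 k \<le> 1)"

definition shift :: "(nat \<Rightarrow> nat \<Rightarrow> real) \<Rightarrow> nat \<Rightarrow> nat \<Rightarrow> real" where
  "shift p i k = p i (Suc k)"

text \<open>
  All positions are treated alike, including the first one, which \<open>expansion\<close> keeps outside its
  series; the term with index \<open>k\<close> belongs to position \<open>k + 1\<close>.
\<close>

definition expansion_term :: "(nat \<Rightarrow> nat \<Rightarrow> real) \<Rightarrow> (nat \<Rightarrow> nat) \<Rightarrow> nat \<Rightarrow> real" where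
  "expansion_term p \<alpha> k = offset p (\<alpha> (Suc k)) (Suc k) * (\<Prod>j = 1..k. p (\<alpha> j) j)"

lemma offset_digits [simp]:
  "offset p 0 k = 0" "offset p (Suc 0) k = p 0 k" "offset p 2 k = p 0 k + p 1 k"
  by (simp_all add: offset_def numeral_2_eq_2)

lemma ternary_weights_shift: "ternary_weights p \<Longrightarrow> ternary_weights (shift p)"
  by (simp add: ternary_weights_def shift_def)

lemma digit_seq_shift: "digit_seq \<alpha> \<Longrightarrow> digit_seq (\<alpha> \<circ> Suc)"
  by (simp add: digit_seq_def)

lemma expansion_term_0: "expansion_term p \<alpha> 0 = offset p (\<alpha> 1) 1"
  by (simp add: expansion_term_def)

lemma expansion_term_Suc:
  "expansion_term p \<alpha> (Suc k) = p (\<alpha> 1) 1 * expansion_term (shift p) (\<alpha> \<circ> Suc) k"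
proof -
  have "(\<Prod>j = 1..Suc k. p (\<alpha> j) j) = p (\<alpha> 1) 1 * (\<Prod>j = Suc 1..Suc k. p (\<alpha> j) j)"
    by (subst prod.atLeast_Suc_atMost) auto
  also have "(\<Prod>j = Suc 1..Suc k. p (\<alpha> j) j) = (\<Prod>j = 1..k. p (\<alpha> (Suc j)) (Suc j))"
    by (rule prod.atLeast_Suc_atMost_Suc_shift[unfolded comp_def])
  finally show ?thesis
    by (simp add: expansion_term_def shift_def offset_def)
qed

lemma expansion_eq_first_plus_suminf:
  "expansion p \<alpha> = offset p (\<alpha> 1) 1 + (\<Sum>k. expansion_term p \<alpha> (Suc k))"
  by (simp add: expansion_def expansion_term_def)

lemma expansion_eq_suminf:
  assumes "summable (expansion_term p \<alpha>)"
  shows "expansion p \<alpha> = (\<Sum>k. expansion_term p \<alpha> k)"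
  using suminf_split_head[OF assms]
  by (simp add: expansion_eq_first_plus_suminf expansion_term_0)

lemma expansion_rec:
  assumes "summable (expansion_term (shift p) (\<alpha> \<circ> Suc))"
  shows "expansion p \<alpha> = offset p (\<alpha> 1) 1 + p (\<alpha> 1) 1 * expansion (shift p) (\<alpha> \<circ> Suc)"
  using assms
  by (simp add: expansion_eq_first_plus_suminf[of p \<alpha>] expansion_term_Suc
      expansion_eq_suminf suminf_mult)

lemma affine_maps_unit_interval:
  fixes a b t :: real
  assumes "0 \<le> a" "a \<le> 1" "0 \<le> a + b" "a + b \<le> 1" "0 \<le> t" "t \<le> 1"
  shows "0 \<le> a + b * t" "a + b * t \<le> 1"
proof -
  have "a + b * t = (1 - t) * a + t * (a + b)"
    by (simp add: algebra_simps)
  moreover have "0 \<le> (1 - t) * a" "(1 - t) * a \<le> 1 - t"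
    "0 \<le> t * (a + b)" "t * (a + b) \<le> t"
    using assms by (auto intro: mult_left_le)
  ultimately show "0 \<le> a + b * t" "a + b * t \<le> 1"
    by - linarith+
qed

text \<open>
  A partial sum is the image of \<open>0\<close> under a composition of the affine maps of the digits, each of
  which preserves the unit interval.
\<close>

lemma partial_sum_in_unit_interval:
  assumes "ternary_weights p" "digit_seq \<alpha>"
  shows "(\<Sum>k<n. expansion_term p \<alpha> k) \<in> {0..1}"
  using assms
proof (induction n arbitrary: p \<alpha>)
  case 0
  then show ?case by simp
next
  case (Suc n)
  have IH: "(\<Sum>k<n. expansion_term (shift p) (\<alpha> \<circ> Suc) k) \<in> {0..1}"
    by (intro Suc.IH ternary_weights_shift digit_seq_shift Suc.prems)
  have "(\<Sum>k<Suc n. expansion_term p \<alpha> k)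
      = offset p (\<alpha> 1) 1 + p (\<alpha> 1) 1 * (\<Sum>k<n. expansion_term (shift p) (\<alpha> \<circ> Suc) k)"
    by (simp only: sum.lessThan_Suc_shift expansion_term_0 expansion_term_Suc sum_distrib_left)
  moreover have "0 \<le> offset p (\<alpha> 1) 1" "offset p (\<alpha> 1) 1 \<le> 1"
    "0 \<le> offset p (\<alpha> 1) 1 + p (\<alpha> 1) 1" "offset p (\<alpha> 1) 1 + p (\<alpha> 1) 1 \<le> 1"
    using Suc.prems by (auto simp: ternary_weights_def digit_seq_def dest!: spec[of _ 1])
  ultimately show ?case
    using IH affine_maps_unit_interval by simp
qed

lemma expansion_in_unit_interval:
  assumes "ternary_weights p" "digit_seq \<alpha>" "summable (expansion_term p \<alpha>)"
  shows "expansion p \<alpha> \<in> {0..1}"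
proof -
  have "(\<lambda>n. \<Sum>k<n. expansion_term p \<alpha> k) \<longlonglongrightarrow> expansion p \<alpha>"
    using assms(3) by (simp add: expansion_eq_suminf summable_LIMSEQ)
  then show ?thesis
    by (rule Lim_in_closed_set[rotated 3])
      (use assms partial_sum_in_unit_interval in auto)
qed

text \<open>
  The entries of a nonnegative matrix may come arbitrarily close to \<open>1\<close>, so its terms need not decay
  geometrically; convergence comes from nonnegative terms with bounded partial sums instead.
\<close>

lemma summable_expansion_term_nonneg:
  assumes "ternary_weights p" "digit_seq \<alpha>"
    and nonneg: "\<And>i k. i \<in> {0, 1, 2} \<Longrightarrow> k \<ge> 1 \<Longrightarrow> p i k \<ge> 0"
  shows "summable (expansion_term p \<alpha>)"
proof (rule bounded_imp_summable)
  show "0 \<le> expansion_term p \<alpha> k" for k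
  proof -
    have "offset p (\<alpha> (Suc k)) (Suc k) \<ge> 0"
      using assms(1,2)
      by (auto simp: ternary_weights_def digit_seq_def dest!: spec[of _ "Suc k"])
    moreover have "(\<Prod>j = 1..k. p (\<alpha> j) j) \<ge> 0"
      using assms(2) by (intro prod_nonneg ballI nonneg) (auto simp: digit_seq_def)
    ultimately show ?thesis
      by (simp add: expansion_term_def)
  qed
  show "(\<Sum>k\<le>n. expansion_term p \<alpha> k) \<le> 1" for n
    using partial_sum_in_unit_interval[OF assms(1,2), of "Suc n"]
    by (simp only: lessThan_Suc_atMost atLeastAtMost_iff)
qed

lemma summable_expansion_term_contractive:
  assumes "ternary_weights p" "digit_seq \<alpha>"
    and "\<And>i k. i \<in> {0, 1, 2} \<Longrightarrow> k \<ge> 1 \<Longrightarrow> \<bar>p i k\<bar> \<le> c" and "c < 1"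
  shows "summable (expansion_term p \<alpha>)"
proof (rule summable_comparison_test)
  have "0 \<le> c"
    using assms(3)[of 0 1] by simp
  then show "summable (\<lambda>k. c ^ k)"
    using \<open>c < 1\<close> by (simp add: summable_geometric)
  have "norm (expansion_term p \<alpha> k) \<le> c ^ k" for k
  proof -
    have "\<bar>offset p (\<alpha> (Suc k)) (Suc k)\<bar> \<le> 1"
      using assms(1,2)
      by (auto simp: ternary_weights_def digit_seq_def dest!: spec[of _ "Suc k"])
    moreover have "(\<Prod>j = 1..k. \<bar>p (\<alpha> j) j\<bar>) \<le> (\<Prod>j = 1..k. c)"
      using assms(2) by (intro prod_mono conjI assms(3)) (auto simp: digit_seq_def)
    then have "\<bar>\<Prod>j = 1..k. p (\<alpha> j) j\<bar> \<le> c ^ k"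
      by (simp add: abs_prod)
    ultimately have "\<bar>offset p (\<alpha> (Suc k)) (Suc k)\<bar> * \<bar>\<Prod>j = 1..k. p (\<alpha> j) j\<bar> \<le> 1 * c ^ k"
      by (intro mult_mono) auto
    then show ?thesis
      by (simp add: expansion_term_def abs_mult)
  qed
  then show "\<exists>N. \<forall>n\<ge>N. norm (expansion_term p \<alpha> n) \<le> c ^ n"
    by blast
qed

section \<open>Continuous approximations\<close>

text \<open>
  The three branches are the cylinders of the first digits \<open>0\<close>, \<open>1\<close>, \<open>2\<close>. The rescaled argument is
  the number whose expansion begins at the second position, so both matrices are shifted.
\<close>

primrec digit_approx ::
    "nat \<Rightarrow> (nat \<Rightarrow> nat \<Rightarrow> real) \<Rightarrow> (nat \<Rightarrow> nat \<Rightarrow> real) \<Rightarrow> real \<Rightarrow> real" where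
  "digit_approx 0 q g x = x"
| "digit_approx (Suc n) q g x =
    (if x \<le> q 0 1 then g 0 1 * digit_approx n (shift q) (shift g) (x / q 0 1)
     else if x \<le> q 0 1 + q 1 1
     then g 0 1 + g 1 1 * digit_approx n (shift q) (shift g) ((x - q 0 1) / q 1 1)
     else g 0 1 + g 1 1
       + g 2 1 * digit_approx n (shift q) (shift g) ((x - (q 0 1 + q 1 1)) / q 2 1))"

definition positive_weights :: "(nat \<Rightarrow> nat \<Rightarrow> real) \<Rightarrow> bool" where
  "positive_weights q \<longleftrightarrow> ternary_weights q \<and> (\<forall>k\<ge>1. q 0 k > 0 \<and> q 1 k > 0 \<and> q 2 k > 0)"

lemma positive_weights_shift: "positive_weights q \<Longrightarrow> positive_weights (shift q)"
  by (simp add: positive_weights_def ternary_weights_shift) (simp add: shift_def)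

lemma positive_weights_first:
  assumes "positive_weights q"
  shows "q 0 1 > 0" "q 1 1 > 0" "q 2 1 > 0" "q 0 1 + q 1 1 + q 2 1 = 1"
  using assms by (auto simp: positive_weights_def ternary_weights_def)

lemma digit_approx_0:
  assumes "positive_weights q"
  shows "digit_approx n q g 0 = 0"
  using assms
proof (induction n arbitrary: q g)
  case (Suc n)
  then show ?case
    using positive_weights_first[of q] by (simp add: positive_weights_shift)
qed simp

lemma digit_approx_1:
  assumes "positive_weights q" "ternary_weights g"
  shows "digit_approx n q g 1 = 1"
  using assms
proof (induction n arbitrary: q g)
  case (Suc n)
  have "1 - (q 0 1 + q 1 1) = q 2 1" "g 0 1 + g 1 1 + g 2 1 = 1"
    using positive_weights_first[of q] Suc.prems by (auto simp: ternary_weights_def)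
  then show ?case
    using positive_weights_first[of q] Suc
    by (simp add: positive_weights_shift ternary_weights_shift)
qed simp

text \<open>
  At a common endpoint of two neighbouring cylinders the definition picks the left one; the formula
  of the right one gives the same value because the previous approximation fixes \<open>0\<close> and \<open>1\<close>.
\<close>

lemma digit_approx_cylinder:
  assumes q: "positive_weights q" and g: "ternary_weights g"
    and i: "i \<in> {0, 1, 2}" and t: "t \<in> {0..1}"
  shows "digit_approx (Suc n) q g (offset q i 1 + q i 1 * t)
    = offset g i 1 + g i 1 * digit_approx n (shift q) (shift g) t"
proof -
  note q1 = positive_weights_first[OF q]
  note ends = digit_approx_0[OF positive_weights_shift[OF q]]
    digit_approx_1[OF positive_weights_shift[OF q] ternary_weights_shift[OF g]]
  from i consider "i = 0" | "i = 1" | "i = 2" by blast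
  then show ?thesis
  proof cases
    case 1
    have "q 0 1 * t \<le> q 0 1"
      using q1 t by (simp add: mult_left_le)
    then show ?thesis
      using 1 q1 by simp
  next
    case 2
    have "q 1 1 * t \<le> q 1 1"
      using q1 t by (simp add: mult_left_le)
    then show ?thesis
      using 2 q1 t ends by (cases "t = 0") (auto simp: mult_le_0_iff)
  next
    case 3
    have "q 2 1 * t \<ge> 0"
      using q1 t by simp
    then have "\<not> q 0 1 + q 1 1 + q 2 1 * t \<le> q 0 1"
      using q1 by linarith
    then show ?thesis
      using 3 q1 t ends by (cases "t = 0") (auto simp: mult_le_0_iff)
  qed
qed

lemma digit_approx_continuous:
  assumes "positive_weights q" "ternary_weights g"
  shows "continuous_on {0..1} (digit_approx n q g)"
  using assms
proof (induction n arbitrary: q g)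
  case 0
  then show ?case by (simp add: continuous_on_id)
next
  case (Suc n)
  note q = Suc.prems(1) and g = Suc.prems(2)
  note q1 = positive_weights_first[OF q]
  have cont: "continuous_on {0..1} (digit_approx n (shift q) (shift g))"
    using Suc by (simp add: positive_weights_shift ternary_weights_shift)
  have piece: "continuous_on {offset q i 1..offset q i 1 + q i 1} (digit_approx (Suc n) q g)"
    if i: "i \<in> {0, 1, 2}" for i
  proof -
    have pos: "q i 1 > 0"
      using i q1 by auto
    have "continuous_on {offset q i 1..offset q i 1 + q i 1}
        (\<lambda>x. offset g i 1 + g i 1 * digit_approx n (shift q) (shift g) ((x - offset q i 1) / q i 1))"
      by (intro continuous_intros continuous_on_compose2[OF cont])
        (use pos in \<open>auto simp: divide_simps\<close>)
    moreover have "digit_approx (Suc n) q g x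
        = offset g i 1 + g i 1 * digit_approx n (shift q) (shift g) ((x - offset q i 1) / q i 1)"
      if "x \<in> {offset q i 1..offset q i 1 + q i 1}" for x
      using digit_approx_cylinder[OF q g i, of "(x - offset q i 1) / q i 1" n] pos that
      by (simp del: digit_approx.simps add: divide_simps)
    ultimately show ?thesis
      by (subst continuous_on_cong) auto
  qed
  have "{0..1} = {0..q 0 1} \<union> ({q 0 1..q 0 1 + q 1 1} \<union> {q 0 1 + q 1 1..1})"
    using q1 by auto
  moreover have "continuous_on ({0..q 0 1} \<union> ({q 0 1..q 0 1 + q 1 1} \<union> {q 0 1 + q 1 1..1}))
      (digit_approx (Suc n) q g)"
    using piece[of 0] piece[of 1] piece[of 2] q1
    by (intro continuous_on_closed_Un closed_Un closed_atLeastAtMost) (simp_all del: digit_approx.simps)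
  ultimately show ?case
    by simp
qed

text \<open>
  Here \<open>expansion q \<alpha>\<close> and \<open>expansion g \<alpha>\<close> run over the same digits. For \<open>n = 0\<close> both numbers lie
  in the unit interval, and each further digit contributes one factor \<open>\<bar>g i k\<bar> \<le> c\<close>.
\<close>

lemma digit_approx_error:
  assumes "positive_weights q" "ternary_weights g" "digit_seq \<alpha>"
    and "\<And>i k. i \<in> {0, 1, 2} \<Longrightarrow> k \<ge> 1 \<Longrightarrow> \<bar>g i k\<bar> \<le> c" and "c < 1"
  shows "\<bar>digit_approx n q g (expansion q \<alpha>) - expansion g \<alpha>\<bar> \<le> c ^ n"
  using assms
proof (induction n arbitrary: q g \<alpha>)
  case (0 q g \<alpha>)
  have "summable (expansion_term q \<alpha>)"
    using 0 by (intro summable_expansion_term_nonneg) (auto simp: positive_weights_def less_imp_le)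
  then have "expansion q \<alpha> \<in> {0..1}"
    using 0 by (intro expansion_in_unit_interval) (auto simp: positive_weights_def)
  moreover have "summable (expansion_term g \<alpha>)"
    using summable_expansion_term_contractive[OF "0.prems"(2-5)] .
  then have "expansion g \<alpha> \<in> {0..1}"
    using 0 by (intro expansion_in_unit_interval)
  ultimately show ?case
    by auto
next
  case (Suc n q g \<alpha>)
  define i where "i = \<alpha> 1"
  have i: "i \<in> {0, 1, 2}"
    using Suc.prems(3) by (simp add: i_def digit_seq_def)
  note q' = positive_weights_shift[OF Suc.prems(1)]
    and g' = ternary_weights_shift[OF Suc.prems(2)]
    and \<alpha>' = digit_seq_shift[OF Suc.prems(3)]
  have c': "\<bar>shift g j k\<bar> \<le> c" if "j \<in> {0, 1, 2}" "k \<ge> 1" for j k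
    using Suc.prems(4)[of j "Suc k"] that by (simp add: shift_def)
  define t where "t = expansion (shift q) (\<alpha> \<circ> Suc)"
  define s where "s = expansion (shift g) (\<alpha> \<circ> Suc)"
  have sum_q: "summable (expansion_term (shift q) (\<alpha> \<circ> Suc))"
    using q' \<alpha>' by (intro summable_expansion_term_nonneg) (auto simp: positive_weights_def less_imp_le)
  have sum_g: "summable (expansion_term (shift g) (\<alpha> \<circ> Suc))"
    using summable_expansion_term_contractive[OF g' \<alpha>' c' Suc.prems(5)] .
  have t: "t \<in> {0..1}"
    unfolding t_def using q' \<alpha>' sum_q
    by (intro expansion_in_unit_interval) (auto simp: positive_weights_def)
  have "digit_approx (Suc n) q g (expansion q \<alpha>) - expansion g \<alpha>
      = g i 1 * (digit_approx n (shift q) (shift g) t - s)"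
    unfolding expansion_rec[OF sum_q] expansion_rec[OF sum_g]
      i_def[symmetric] t_def[symmetric] s_def[symmetric]
      digit_approx_cylinder[OF Suc.prems(1,2) i t]
    by (simp add: algebra_simps)
  also have "\<bar>\<dots>\<bar> \<le> c * c ^ n"
    unfolding abs_mult
  proof (rule mult_mono)
    show "\<bar>g i 1\<bar> \<le> c"
      using Suc.prems(4)[OF i, of 1] by simp
    then show "0 \<le> c"
      by (rule order_trans[OF abs_ge_zero])
    show "\<bar>digit_approx n (shift q) (shift g) t - s\<bar> \<le> c ^ n"
      unfolding t_def s_def by (intro Suc.IH[OF q' g' \<alpha>' _ Suc.prems(5)] c')
  qed simp
  finally show ?case
    by simp
qed

section \<open>Continuity\<close>

lemma ternary_weights_g_matrix:
  assumes "\<And>k. k \<ge> 1 \<Longrightarrow> 0 \<le> \<epsilon> k \<and> \<epsilon> k \<le> 1"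
  shows "ternary_weights (g_matrix \<epsilon>)"
  unfolding ternary_weights_def
proof (intro allI impI)
  fix k :: nat
  assume "1 \<le> k"
  from assms[OF this]
  show "g_matrix \<epsilon> 0 k + g_matrix \<epsilon> 1 k + g_matrix \<epsilon> 2 k = 1 \<and>
      0 \<le> g_matrix \<epsilon> 0 k \<and> g_matrix \<epsilon> 0 k \<le> 1 \<and>
      0 \<le> g_matrix \<epsilon> 0 k + g_matrix \<epsilon> 1 k \<and> g_matrix \<epsilon> 0 k + g_matrix \<epsilon> 1 k \<le> 1"
    by (simp add: g_matrix_def field_simps)
qed

lemma abs_g_matrix_le:
  assumes "0 \<le> \<epsilon> k" "\<epsilon> k \<le> 1"
  shows "\<bar>g_matrix \<epsilon> i k\<bar> \<le> 2 / 3"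
  using assms by (simp add: g_matrix_def abs_le_iff field_simps)

theorem theorem1:
  fixes q :: "nat \<Rightarrow> nat \<Rightarrow> real" and \<epsilon> :: "nat \<Rightarrow> real"
  assumes q_pos: "\<And>i k. i \<in> {0, 1, 2} \<Longrightarrow> k \<ge> 1 \<Longrightarrow> q i k > 0"
    and q_sum: "\<And>k. k \<ge> 1 \<Longrightarrow> q 0 k + q 1 k + q 2 k = 1"
    and representation:
      "\<And>x. x \<in> {0..1} \<Longrightarrow> \<exists>\<alpha>. digit_seq \<alpha> \<and> x = expansion q \<alpha>"
    and eps: "\<And>k. k \<ge> 1 \<Longrightarrow> 0 \<le> \<epsilon> k \<and> \<epsilon> k \<le> 1"
  shows "\<forall>x\<in>{0..1}. continuous (at x within {0..1}) (Q3_fun q \<epsilon>)"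
proof -
  let ?g = "g_matrix \<epsilon>"
  let ?F = "\<lambda>n. digit_approx n q ?g"
  have q: "positive_weights q"
    unfolding positive_weights_def ternary_weights_def
  proof (intro conjI allI impI)
    fix k :: nat
    assume k: "1 \<le> k"
    note facts = q_pos[of 0 k] q_pos[of 1 k] q_pos[of 2 k] q_sum[OF k] k
    show "q 0 k > 0" "q 1 k > 0" "q 2 k > 0" "q 0 k + q 1 k + q 2 k = 1"
      "0 \<le> q 0 k" "q 0 k \<le> 1" "0 \<le> q 0 k + q 1 k" "q 0 k + q 1 k \<le> 1"
      using facts by simp_all
  qed
  have g: "ternary_weights ?g"
    using eps by (rule ternary_weights_g_matrix)
  have error: "\<bar>?F n (expansion q \<alpha>) - expansion ?g \<alpha>\<bar> \<le> (2 / 3) ^ n" if "digit_seq \<alpha>" for n \<alpha>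
    using eps by (intro digit_approx_error[OF q g that] abs_g_matrix_le) auto
  have geom: "(\<lambda>n. (2 / 3 :: real) ^ n) \<longlonglongrightarrow> 0"
    by (rule LIMSEQ_realpow_zero) auto
  have lim: "(\<lambda>n. ?F n (expansion q \<alpha>)) \<longlonglongrightarrow> expansion ?g \<alpha>" if "digit_seq \<alpha>" for \<alpha>
    using Lim_null_comparison[OF _ geom, of "\<lambda>n. ?F n (expansion q \<alpha>) - expansion ?g \<alpha>"]
      error[OF that] by (simp add: LIM_zero_iff)
  \<comment> \<open>Two representations of one number are limits of the same sequence, so their values agree.\<close>
  have Q3_fun_expansion: "Q3_fun q \<epsilon> (expansion q \<alpha>) = expansion ?g \<alpha>" if \<alpha>: "digit_seq \<alpha>" for \<alpha>
    unfolding Q3_fun_def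
  proof (rule the_equality)
    fix y
    assume "\<exists>\<gamma>. digit_seq \<gamma> \<and> expansion q \<alpha> = expansion q \<gamma> \<and> y = expansion ?g \<gamma>"
    then show "y = expansion ?g \<alpha>"
      using lim[OF \<alpha>] lim LIMSEQ_unique by metis
  qed (use \<alpha> in blast)
  have "uniform_limit {0..1} ?F (Q3_fun q \<epsilon>) sequentially"
  proof (rule uniform_limitI)
    fix e :: real
    assume "e > 0"
    then have "\<forall>\<^sub>F n in sequentially. (2 / 3 :: real) ^ n < e"
      using order_tendstoD(2)[OF geom] by blast
    then show "\<forall>\<^sub>F n in sequentially. \<forall>x\<in>{0..1}. dist (?F n x) (Q3_fun q \<epsilon> x) < e"
    proof eventually_elim
      case (elim n)
      show ?case
      proof
        fix x :: real
        assume "x \<in> {0..1}"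
        then obtain \<alpha> where \<alpha>: "digit_seq \<alpha>" "x = expansion q \<alpha>"
          using representation by blast
        show "dist (?F n x) (Q3_fun q \<epsilon> x) < e"
          using error[OF \<alpha>(1), of n] elim by (simp add: \<alpha>(2) Q3_fun_expansion[OF \<alpha>(1)] dist_real_def)
      qed
    qed
  qed
  then have "continuous_on {0..1} (Q3_fun q \<epsilon>)"
    by (rule uniform_limit_theorem[rotated])
      (use digit_approx_continuous[OF q g] in \<open>auto intro: always_eventually\<close>)
  then show ?thesis
    by (simp add: continuous_on_eq_continuous_within)
qed

end
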